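(* Let $h\colon \mathbb{R}\to\mathbb{R}$ be an increasing homeomorphism such that $$\int_{\mathbb{H}} e^{q \rho_h(x,y)} \, d\sigma(x,y) <\infty$$ for some $q>0$. Then there exists an extension of $h$ to a homeomorphism of $\mathbb{H}$ that has exponentially integrable distortion.
   Context: $\mathbb{H}=\{(x,y)\in\mathbb{R}^2: y>0\}$ is the upper half-plane, with boundary $\mathbb{R}$ (identified with $\{y=0\}$). $\sigma$ denotes the spherical measure on the Riemann sphere $\widehat{\mathbb{C}}$; in planar coordinates $d\sigma = \frac{4\,dx\,dy}{(1+x^2+y^2)^2}$. For an increasing homeomorphism $h\colon\mathbb{R}\to\mathbb{R}$, $x\in\mathbb{R}$, $t>0$, the symmetric distortion function is $$\rho_h(x,t)= \max \left\{ \frac{|h(x+t)-h(x)|}{|h(x)-h(x-t)|}, \frac{|h(x)-h(x-t)|}{|h(x+t)-h(x)|}\right\}.$$ A homeomorphism $H\colon U\to V$ between open sets $U,V\subset\mathbb{R}^2$ is a mapping of finite distortion if $H$ is orientation-preserving, $H\in W^{1,1}_{\mathrm{loc}}(U)$, the Jacobian $J_H$ lies in $L^1_{\mathrm{loc}}(U)$, and the quasiconformal dilatation $K_H(x,y)=\inf\{K\ge 1: \|DH(x,y)\|^2\le K J_H(x,y)\}$ (with $\|DH\|$ the operator norm of the differential matrix) is finite a.e. in $U$. It has exponentially integrable distortion if moreover $\int_U e^{pK_H}\,d\sigma<\infty$ for some $p>0$. An extension of $h$ to a homeomorphism of $\mathbb{H}$ is a homeomorphism $H\colon\overline{\mathbb{H}}\to\overline{\mathbb{H}}$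 (where $\overline{\mathbb H}=\mathbb H\cup\mathbb R$) with $H(\mathbb{H})=\mathbb{H}$ and $H|_{\mathbb{R}}=h$; the distortion condition refers to $H|_{\mathbb{H}}$. *)

theory Defs
  imports "HOL-Complex_Analysis.Complex_Analysis"
begin

text \<open>
  The plane is the type \<^typ>\<open>complex\<close>, the point $(x,y)$ being \<^term>\<open>Complex x y\<close>; complex
  multiplication plays no role except through winding numbers.
\<close>

definition upper_half_plane :: "complex set" where
  "upper_half_plane = {z. Im z > 0}"

definition closed_upper_half_plane :: "complex set" where
  "closed_upper_half_plane = {z. Im z \<ge> 0}"

definition spherical_measure :: "complex measure" where
  "spherical_measure = density lebesgue (\<lambda>z. ennreal (4 / (1 + (Re z)\<^sup>2 + (Im z)\<^sup>2)\<^sup>2))"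

definition increasing_homeomorphism :: "(real \<Rightarrow> real) \<Rightarrow> bool" where
  "increasing_homeomorphism h \<longleftrightarrow> strict_mono h \<and> (\<exists>g. homeomorphism UNIV UNIV h g)"

definition symmetric_distortion :: "(real \<Rightarrow> real) \<Rightarrow> real \<Rightarrow> real \<Rightarrow> real" where
  "symmetric_distortion h x t =
     max (\<bar>h (x + t) - h x\<bar> / \<bar>h x - h (x - t)\<bar>)
         (\<bar>h x - h (x - t)\<bar> / \<bar>h (x + t) - h x\<bar>)"

text \<open>Test functions: the class $C_c^\infty(U)$ of smooth real functions with compact support in U.\<close>

primrec C_k :: "nat \<Rightarrow> (complex \<Rightarrow> real) \<Rightarrow> bool" where
  "C_k 0 \<phi> \<longleftrightarrow> continuous_on UNIV \<phi>"
| "C_k (Suc k) \<phi> \<longleftrightarrow> \<phi> differentiable_on UNIV \<and> (\<forall>v. C_k k (\<lambda>z. frechet_derivative \<phi> (at z) v))"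

definition test_function :: "complex set \<Rightarrow> (complex \<Rightarrow> real) \<Rightarrow> bool" where
  "test_function U \<phi> \<longleftrightarrow>
     (\<forall>k. C_k k \<phi>) \<and> compact (closure {z. \<phi> z \<noteq> 0}) \<and> closure {z. \<phi> z \<noteq> 0} \<subseteq> U"

definition locally_integrable_on :: "(complex \<Rightarrow> 'b::euclidean_space) \<Rightarrow> complex set \<Rightarrow> bool"
    (infix "locally'_integrable'_on" 50) where
  "f locally_integrable_on U \<longleftrightarrow> (\<forall>K. compact K \<and> K \<subseteq> U \<longrightarrow> f absolutely_integrable_on K)"

definition has_weak_directional_derivative ::
    "complex set \<Rightarrow> complex \<Rightarrow> (complex \<Rightarrow> complex) \<Rightarrow> (complex \<Rightarrow> complex) \<Rightarrow> bool" where
  "has_weak_directional_derivative U v f g \<longleftrightarrow>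
     (\<forall>\<phi>. test_function U \<phi> \<longrightarrow>
        (LINT z:U|lebesgue. frechet_derivative \<phi> (at z) v *\<^sub>R f z) =
        - (LINT z:U|lebesgue. \<phi> z *\<^sub>R g z))"

text \<open>
  \<open>W11_loc_with U H DH\<close> says that H lies in $W^{1,1}_{loc}(U)$ and that \<open>DH z\<close>, a real-linear map of
  the plane for each z, is its weak differential; \<open>DH z 1\<close> and \<open>DH z \<i>\<close> are the weak partial
  derivatives in x and y.  The weak differential is unique up to a null set, so
  existential quantification over \<open>DH\<close> below does not depend on the representative.
\<close>

definition W11_loc_with ::
    "complex set \<Rightarrow> (complex \<Rightarrow> complex) \<Rightarrow> (complex \<Rightarrow> complex \<Rightarrow> complex) \<Rightarrow> bool" where
  "W11_loc_with U H DH \<longleftrightarrow>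
     H locally_integrable_on U \<and> (\<forall>z. linear (DH z)) \<and>
     (\<forall>v\<in>{1, \<i>}. (\<lambda>z. DH z v) locally_integrable_on U \<and>
                 has_weak_directional_derivative U v H (\<lambda>z. DH z v))"

definition jacobian :: "(complex \<Rightarrow> complex) \<Rightarrow> real" where
  "jacobian L = det (vector [vector [Re (L 1), Re (L \<i>)],
                             vector [Im (L 1), Im (L \<i>)]] :: real^2^2)"

text \<open>In \<^typ>\<open>ennreal\<close> the infimum of the empty set is \<^term>\<open>\<infinity>\<close>.\<close>

definition dilatation :: "(complex \<Rightarrow> complex) \<Rightarrow> ennreal" where
  "dilatation L = (INF K\<in>{K::real. 1 \<le> K \<and> (onorm L)\<^sup>2 \<le> K * jacobian L}. ennreal K)"

text \<open>
  A planar homeomorphism preserves orientation if it maps small positively oriented circles to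
  curves of winding number +1 around the image of the centre (local degree +1 everywhere).
\<close>

definition orientation_preserving_on :: "complex set \<Rightarrow> (complex \<Rightarrow> complex) \<Rightarrow> bool" where
  "orientation_preserving_on U H \<longleftrightarrow>
     (\<forall>z r. r > 0 \<and> cball z r \<subseteq> U \<longrightarrow> winding_number (H \<circ> circlepath z r) (H z) = 1)"

text \<open>\<open>H : U \<rightarrow> V\<close> is a mapping of finite distortion whose weak differential is \<open>DH\<close>.\<close>

definition finite_distortion_with ::
    "complex set \<Rightarrow> complex set \<Rightarrow> (complex \<Rightarrow> complex) \<Rightarrow> (complex \<Rightarrow> complex \<Rightarrow> complex) \<Rightarrow> bool"
  where
  "finite_distortion_with U V H DH \<longleftrightarrow>
     open U \<and> open V \<and> (\<exists>G. homeomorphism U V H G) \<and>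
     orientation_preserving_on U H \<and>
     W11_loc_with U H DH \<and>
     (\<lambda>z. jacobian (DH z)) locally_integrable_on U \<and>
     (AE z in lebesgue. z \<in> U \<longrightarrow> dilatation (DH z) < \<infinity>)"

definition exp_times :: "real \<Rightarrow> ennreal \<Rightarrow> ennreal" where
  "exp_times p K = (if K = \<infinity> then \<infinity> else ennreal (exp (p * enn2real K)))"

definition exponentially_integrable_distortion ::
    "complex set \<Rightarrow> complex set \<Rightarrow> (complex \<Rightarrow> complex) \<Rightarrow> bool" where
  "exponentially_integrable_distortion U V H \<longleftrightarrow>
     (\<exists>DH. finite_distortion_with U V H DH \<and>
       (\<exists>p>0. (\<integral>\<^sup>+z\<in>U. exp_times p (dilatation (DH z)) \<partial>spherical_measure) < \<infinity>))"

definition homeomorphic_extension :: "(real \<Rightarrow> real) \<Rightarrow> (complex \<Rightarrow> complex) \<Rightarrow> bool" where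
  "homeomorphic_extension h H \<longleftrightarrow>
     (\<exists>G. homeomorphism closed_upper_half_plane closed_upper_half_plane H G) \<and>
     H ` upper_half_plane = upper_half_plane \<and>
     (\<forall>x. H (complex_of_real x) = complex_of_real (h x))"

end

theory Submission
  imports Defs
begin

text \<open>
  The Beurling-Ahlfors extension has the required property.  With the mean
  $A(x,y)=\int_0^1 h(x+ty)\,dt$, defined for all real $y$, it is
  $H=\frac12(A(x,y)+A(x,-y))+\frac i2(A(x,y)-A(x,-y))$.

  Topology.  The mean $A$ is strictly increasing in each of its variables, and this alone makes the
  map $H$ injective on the whole plane (\<open>inj_symmetrize\<close>).  As $H$ is proper, it is a homeomorphism of
  the plane by invariance of domain; it maps $z$ to the same side of the real axis and equals $h$ on the
  axis.  Deforming $A$ linearly to $x+y$ deforms $H$ to the identity through injective maps, so $H$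
  preserves orientation (\<open>orientation_preserving_symmetrize\<close>).

  Regularity.  Off the real axis $H$ is continuously differentiable, and a continuously
  differentiable map has its classical derivatives as weak derivatives
  (\<open>has_weak_directional_derivative_of_C1\<close>).

  Distortion.  The quasiconformality estimate for this extension usually quoted multiplies symmetric
  distortions at several scales and would ruin exponential integrability.  The dilatation is however
  bounded linearly, by 64 times the largest of $\rho_h(x,y)$ and $\rho_h(x\pm y/4,y/2)$
  (\<open>dilatation_beurling_ahlfors_le\<close>): it can exceed a multiple of $\rho_h(x,y)$ only if $h$ rises steeply
  near $x$ from both sides.  The shifted distortions compare the increments of $h$ over two adjacent
  intervals, one of which has $x$ in its interior and so receives the steep part, while the other is
  nearly flat; one of them is then at least of the order of the dilatation.

  Integration.  The maps $(x,y)\mapsto(x\pm y/4,y/2)$ are linear and distort the spherical measure by a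
  bounded factor (\<open>nn_integral_spherical_shear_le\<close>), so the exponential integrals of all three
  distortions are controlled by the given one.
\<close>

section \<open>Symmetrization of separately increasing functions\<close>

text \<open>
  Extensions are built in the whole plane, symmetric under reflection in the real axis.  If
  $A(z)$ is to play the role of a mean of h over the interval from $x$ to $x+y$, where $z=x+iy$,
  then $A(\overline z)$ is the mean over $[x-y,x]$, and the Beurling-Ahlfors formula has their
  half-sum as real and their half-difference as imaginary part.
\<close>

definition symmetrize :: "(complex \<Rightarrow> real) \<Rightarrow> complex \<Rightarrow> complex" where
  "symmetrize A z = Complex ((A z + A (cnj z)) / 2) ((A z - A (cnj z)) / 2)"

definition separately_increasing :: "(complex \<Rightarrow> real) \<Rightarrow> bool" where
  "separately_increasing A \<longleftrightarrow>
     (\<forall>y. strict_mono (\<lambda>x. A (Complex x y))) \<and> (\<forall>x. strict_mono (\<lambda>y. A (Complex x y)))"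

lemma separately_increasing_less:
  assumes "separately_increasing A" "x \<le> x'" "y \<le> y'" "x < x' \<or> y < y'"
  shows "A (Complex x y) < A (Complex x' y')"
proof -
  have 1: "A (Complex x y) < A (Complex x' y)" if "x < x'" for x x' y
    using assms(1) that by (auto simp: separately_increasing_def strict_mono_def)
  have 2: "A (Complex x y) < A (Complex x y')" if "y < y'" for x y y'
    using assms(1) that by (auto simp: separately_increasing_def strict_mono_def)
  show ?thesis
    using assms(2-4) 1[of x x' y] 2[of y y' x'] by (cases "x = x'"; cases "y = y'") auto
qed

text \<open>
  The two values determine the point: from $A(x,y)=A(x',y')$ and $x<x'$ it follows that $y>y'$,
  while $A(x,-y)=A(x',-y')$ and $x<x'$ give $-y>-y'$.  Stated for all such functions $A$, the lemma
  also covers every map on a straight-line homotopy between two symmetrizations.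
\<close>

lemma inj_symmetrize:
  assumes A: "separately_increasing A"
  shows "inj (symmetrize A)"
proof (rule injI)
  have key: False
    if 1: "A (Complex x y) = A (Complex x' y')" and 2: "A (Complex x (-y)) = A (Complex x' (-y'))"
      and "x < x'" for x y x' y'
    using separately_increasing_less[OF A, of x x' y y']
      separately_increasing_less[OF A, of x x' "-y" "-y'"] that by (cases "y \<le> y'") auto
  fix z w assume "symmetrize A z = symmetrize A w"
  hence *: "A z = A w" "A (cnj z) = A (cnj w)"
    by (auto simp: symmetrize_def field_simps)
  have cnj: "cnj u = Complex (Re u) (- Im u)" for u
    by (simp add: complex_eq_iff)
  have **: "A (Complex (Re z) (Im z)) = A (Complex (Re w) (Im w))"
      "A (Complex (Re z) (- Im z)) = A (Complex (Re w) (- Im w))"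
    using * unfolding cnj by simp_all
  have "Re z = Re w"
    using key[OF **] key[OF **[symmetric]] by (meson linorder_neqE_linordered_idom)
  moreover have "Im z = Im w"
    using separately_increasing_less[OF A, of "Re z" "Re w" "Im z" "Im w"]
      separately_increasing_less[OF A, of "Re w" "Re z" "Im w" "Im z"] **(1) \<open>Re z = Re w\<close>
    by (cases "Im z" "Im w" rule: linorder_cases) auto
  ultimately show "z = w" by (simp add: complex_eq_iff)
qed

lemma continuous_on_symmetrize:
  assumes "continuous_on UNIV A"
  shows "continuous_on UNIV (symmetrize A)"
  unfolding symmetrize_def Complex_eq
  by (intro continuous_intros continuous_on_compose2[OF assms]) auto

lemma symmetrize_affine:
  "symmetrize (\<lambda>z. (1 - s) * A z + s * (Re z + Im z)) z = (1 - s) *\<^sub>R symmetrize A z + s *\<^sub>R z"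
  by (simp add: symmetrize_def complex_eq_iff field_simps)

text \<open>
  The identity is the symmetrization of $x+y$, and convex combinations of separately increasing
  functions are separately increasing.  So the straight-line homotopy from \<open>symmetrize A\<close> to the
  identity runs through injective maps; the image of a circle never meets the image of its centre
  during it, and the winding number stays that of the circle itself.
\<close>

lemma orientation_preserving_symmetrize:
  assumes A: "separately_increasing A" and cont: "continuous_on UNIV A"
  shows "orientation_preserving_on U (symmetrize A)"
  unfolding orientation_preserving_on_def
proof (intro allI impI, elim conjE)
  fix z :: complex and r :: real assume r: "r > 0"
  let ?H = "symmetrize A" and ?c = "circlepath z r"
  have si: "separately_increasing (\<lambda>z. (1 - s) * A z + s * (Re z + Im z))"
    if s: "0 \<le> s" "s \<le> 1" for s
  proof -
    have "(1 - s) * a + s * b < (1 - s) * a' + s * b'" if "a < a'" "b < b'" for a a' b b' :: real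
      using s that by (cases "s = 0") (auto intro!: add_le_less_mono mult_left_mono)
    thus ?thesis
      using A unfolding separately_increasing_def strict_mono_def by simp
  qed
  have "homotopic_loops (-{0}) (\<lambda>t. ?H (?c t) - ?H z) (\<lambda>t. ?c t - z)"
  proof (rule homotopic_loops_linear)
    have "continuous_on {0..1} ?c" using path_circlepath[of z r] by (simp add: path_def)
    thus "path (\<lambda>t. ?H (?c t) - ?H z)" "path (\<lambda>t. ?c t - z)"
      unfolding path_def
      by (auto intro!: continuous_intros continuous_on_compose2[OF continuous_on_symmetrize[OF cont]])
    fix t :: real assume t: "t \<in> {0..1}"
    have "?c t \<noteq> z" using r by (simp add: circlepath)
    show "closed_segment (?H (?c t) - ?H z) (?c t - z) \<subseteq> - {0}"
    proof
      fix w assume "w \<in> closed_segment (?H (?c t) - ?H z) (?c t - z)"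
      then obtain s where s: "0 \<le> s" "s \<le> 1"
        and w: "w = (1 - s) *\<^sub>R (?H (?c t) - ?H z) + s *\<^sub>R (?c t - z)"
        by (auto simp: closed_segment_def)
      let ?B = "\<lambda>z. (1 - s) * A z + s * (Re z + Im z)"
      have "w = symmetrize ?B (?c t) - symmetrize ?B z"
        unfolding symmetrize_affine w by (simp add: algebra_simps)
      thus "w \<in> - {0}"
        using injD[OF inj_symmetrize[OF si[OF s]], of "?c t" z] \<open>?c t \<noteq> z\<close> by auto
    qed
  qed (use pathfinish_circlepath[of z r] pathstart_circlepath[of z r] in \<open>auto simp: pathfinish_def pathstart_def\<close>)
  hence "winding_number (\<lambda>t. ?H (?c t) - ?H z) 0 = winding_number (\<lambda>t. ?c t - z) 0"
    by (rule winding_number_homotopic_loops)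
  thus "winding_number (?H \<circ> ?c) (?H z) = 1"
    using winding_number_circlepath_centre[OF r, of z]
    by (simp add: winding_number_offset[of _ z] winding_number_offset[of _ "?H z"] o_def)
qed

section \<open>The Beurling-Ahlfors extension as a homeomorphism\<close>

definition forward_mean :: "(real \<Rightarrow> real) \<Rightarrow> complex \<Rightarrow> real" where
  "forward_mean h z = integral {0..1} (\<lambda>t. h (Re z + t * Im z))"

abbreviation beurling_ahlfors :: "(real \<Rightarrow> real) \<Rightarrow> complex \<Rightarrow> complex" where
  "beurling_ahlfors h \<equiv> symmetrize (forward_mean h)"

lemma increasing_homeomorphismD:
  assumes "increasing_homeomorphism h"
  shows "strict_mono h" "continuous_on S h" "surj h"
  using assms continuous_on_subset
  unfolding increasing_homeomorphism_def homeomorphism_def by blast+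

lemma continuous_on_forward_mean:
  assumes h: "continuous_on UNIV h"
  shows "continuous_on UNIV (forward_mean h)"
proof -
  have "continuous_on (UNIV \<times> cbox 0 1) (\<lambda>(z, t). h (Re z + t * Im z))"
    by (auto simp: case_prod_beta intro!: continuous_intros continuous_on_compose2[OF h])
  from integral_continuous_on_param[OF this] show ?thesis
    by (simp add: forward_mean_def[abs_def])
qed

lemma forward_mean_integrand_continuous:
  assumes h: "continuous_on UNIV (h :: real \<Rightarrow> real)"
  shows "continuous_on S (\<lambda>t. h (x + t * y))"
  by (auto intro!: continuous_intros continuous_on_compose2[OF h])

lemma separately_increasing_forward_mean:
  assumes h: "increasing_homeomorphism h"
  shows "separately_increasing (forward_mean h)"
  unfolding separately_increasing_def strict_mono_def forward_mean_def
  using increasing_homeomorphismD[OF h]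
  by (auto intro!: integral_less_real forward_mean_integrand_continuous simp: strict_mono_less)

lemma forward_mean_of_real [simp]: "Im z = 0 \<Longrightarrow> forward_mean h z = h (Re z)"
  by (simp add: forward_mean_def)

lemma forward_mean_between:
  assumes h: "increasing_homeomorphism h" and "y > 0"
  shows "h x < forward_mean h (Complex x y)" "forward_mean h (Complex x y) < h (x + y)"
    "h (x - y) < forward_mean h (Complex x (-y))" "forward_mean h (Complex x (-y)) < h x"
proof -
  note h' = increasing_homeomorphismD[OF h]
  have "integral {0..1} (\<lambda>_::real. h x) < forward_mean h (Complex x y)"
    "forward_mean h (Complex x y) < integral {0..1} (\<lambda>_::real. h (x + y))"
    "integral {0..1} (\<lambda>_::real. h (x - y)) < forward_mean h (Complex x (-y))"
    "forward_mean h (Complex x (-y)) < integral {0..1} (\<lambda>_::real. h x)"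
    unfolding forward_mean_def
    using h' \<open>y > 0\<close>
    by (auto simp del: integral_const_real
        intro!: integral_less_real continuous_intros continuous_on_compose2[OF h'(2)[of UNIV]]
        simp: strict_mono_less)
  thus "h x < forward_mean h (Complex x y)" "forward_mean h (Complex x y) < h (x + y)"
    "h (x - y) < forward_mean h (Complex x (-y))" "forward_mean h (Complex x (-y)) < h x"
    by simp_all
qed

text \<open>
  The breakpoint 1/4 corresponds to the points $x\pm y/4$ at which symmetric distortions are compared with the
  dilatation later on.
\<close>

lemma integral_ge_two_steps:
  assumes f: "continuous_on {0..1::real} f"
    and a: "\<And>t. t \<in> {0..1/4} \<Longrightarrow> (a::real) \<le> f t" and b: "\<And>t. t \<in> {1/4..1} \<Longrightarrow> b \<le> f t"
  shows "(a + 3 * b) / 4 \<le> integral {0..1} (f :: real \<Rightarrow> real)"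
proof -
  have i: "f integrable_on S" if "S = {0..1} \<or> S = {0..1/4} \<or> S = {1/4..1}" for S
    using that by (auto intro!: integrable_continuous_interval intro: continuous_on_subset[OF f])
  have "integral {0..1/4::real} (\<lambda>_. a) \<le> integral {0..1/4} f"
    by (rule integral_le) (use i a in auto)
  moreover have "integral {1/4..1::real} (\<lambda>_. b) \<le> integral {1/4..1} f"
    by (rule integral_le) (use i b in auto)
  moreover have "integral {0..1/4} f + integral {1/4..1} f = integral {0..1} f"
    by (rule Henstock_Kurzweil_Integration.integral_combine) (use i in auto)
  ultimately show ?thesis by simp
qed

lemma forward_mean_quarter:
  assumes h: "increasing_homeomorphism h" and y: "y \<ge> 0"
  shows "(h x + 3 * h (x + y/4)) / 4 \<le> forward_mean h (Complex x y)"
    "forward_mean h (Complex x y) \<le> (h (x + y/4) + 3 * h (x + y)) / 4"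
    "(h (x - y/4) + 3 * h (x - y)) / 4 \<le> forward_mean h (Complex x (-y))"
proof -
  note h' = increasing_homeomorphismD[OF h]
  have c: "continuous_on {0..1} (\<lambda>t. h (x + t * b))" for b
    by (rule forward_mean_integrand_continuous[OF h'(2)])
  have *: "t * y \<le> y/4" if "t \<le> 1/4" for t using mult_right_mono[OF that y] by simp
  have **: "y/4 \<le> t * y" if "1/4 \<le> t" for t using mult_right_mono[OF that y] by simp
  have ***: "t * y \<le> y" if "t \<le> 1" for t using mult_right_mono[OF that y] by simp
  note le = strict_mono_less_eq[OF h'(1)]
  show "(h x + 3 * h (x + y/4)) / 4 \<le> forward_mean h (Complex x y)"
    unfolding forward_mean_def complex.sel
    by (rule integral_ge_two_steps[OF c]) (use y ** in \<open>auto simp: le\<close>)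
  show "(h (x - y/4) + 3 * h (x - y)) / 4 \<le> forward_mean h (Complex x (-y))"
    unfolding forward_mean_def complex.sel
    by (rule integral_ge_two_steps[OF c]) (use y * *** in \<open>auto simp: le\<close>)
  have "(- h (x + y/4) + 3 * (- h (x + y))) / 4 \<le> integral {0..1} (\<lambda>t. - h (x + t * y))"
    by (rule integral_ge_two_steps[OF continuous_on_minus[OF c]])
       (use y * *** in \<open>auto simp: le\<close>)
  thus "forward_mean h (Complex x y) \<le> (h (x + y/4) + 3 * h (x + y)) / 4"
    by (simp add: forward_mean_def)
qed

lemma symmetrize_cnj: "symmetrize A (cnj z) = cnj (symmetrize A z)"
  by (simp add: symmetrize_def complex_eq_iff add_divide_distrib diff_divide_distrib)

lemma Re_plus_Im_symmetrize:
  "A z = Re (symmetrize A z) + Im (symmetrize A z)"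
  "A (cnj z) = Re (symmetrize A z) - Im (symmetrize A z)"
  by (simp_all add: symmetrize_def add_divide_distrib diff_divide_distrib)

lemma cnj_Complex: "cnj (Complex x y) = Complex x (- y)"
  by (simp add: complex_eq_iff)

text \<open>
  The value $h(x)$ lies between the two means at $(x,y)$ and $(x,-y)$, so bounded means confine $x$ to a
  compact interval, h being onto.  The forward mean is at least $(h(x)+3h(x+y/4))/4$, so $x+y/4$ and
  hence $y$ are bounded as well.  The lower half-plane follows by reflection.
\<close>

lemma bounded_beurling_ahlfors_vimage:
  assumes h: "increasing_homeomorphism h"
  shows "bounded {z. norm (beurling_ahlfors h z) \<le> M}"
proof -
  note h' = increasing_homeomorphismD[OF h]
  \<comment> \<open>The bound 4M leaves room for the 10M/3 that the two-step estimate yields for h(x + y/4).\<close>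
  obtain a b where a: "h a = - 2 * M" and b: "h b = 4 * M"
    using h'(3) by (metis surjD)
  have upper: "norm (Complex x y) \<le> \<bar>a\<bar> + \<bar>b\<bar> + 4 * (b - a)"
    if y: "y \<ge> 0" and le: "norm (beurling_ahlfors h (Complex x y)) \<le> M" for x y
  proof -
    let ?A = "forward_mean h"
    have M: "M \<ge> 0" using le norm_ge_zero order_trans by blast
      have bd: "\<bar>?A (Complex x y)\<bar> \<le> 2 * M" "\<bar>?A (Complex x (-y))\<bar> \<le> 2 * M"
      using Re_plus_Im_symmetrize[of ?A "Complex x y"] le
        abs_Re_le_cmod[of "beurling_ahlfors h (Complex x y)"]
        abs_Im_le_cmod[of "beurling_ahlfors h (Complex x y)"] unfolding cnj_Complex by linarith+
    have "?A (Complex x (-y)) \<le> h x" "h x \<le> ?A (Complex x y)"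
      using forward_mean_between(1,4)[OF h, of y x] y by (cases "y = 0"; simp)+
    hence hx: "- 2 * M \<le> h x" "h x \<le> 2 * M" using bd by linarith+
    moreover have "h (x + y/4) \<le> 4 * M"
    proof -
      have *: "c \<le> 4 * M" if "(d + 3 * c) / 4 \<le> e" "e \<le> 2 * M" "- 2 * M \<le> d" for c d e
        using that M by (simp add: field_simps)
      show ?thesis
        by (rule *[OF forward_mean_quarter(1)[OF h y, of x] abs_le_D1[OF bd(1)] hx(1)])
    qed
    ultimately have "h a \<le> h x" "h x \<le> h b" "h (x + y/4) \<le> h b"
      using a b M by simp_all
    hence "a \<le> x" "x \<le> b" "x + y/4 \<le> b" by (simp_all add: strict_mono_less_eq[OF h'(1)])
    thus ?thesis using cmod_le[of "Complex x y"] y by simp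
  qed
  have "norm z \<le> \<bar>a\<bar> + \<bar>b\<bar> + 4 * (b - a)" if "norm (beurling_ahlfors h z) \<le> M" for z
  proof (cases "Im z \<ge> 0")
    case True thus ?thesis using upper[of "Im z" "Re z"] that by simp
  next
    case False
    have "cnj z = Complex (Re z) (- Im z)" by (simp add: complex_eq_iff)
    thus ?thesis
      using False that upper[of "- Im z" "Re z"] symmetrize_cnj[of "forward_mean h" z]
        complex_mod_cnj[of z] by simp
  qed
  thus ?thesis by (auto simp: bounded_iff)
qed

text \<open>
  The range is open by invariance of domain and closed by properness, hence everything.
\<close>

lemma homeomorphism_of_proper_injection:
  fixes f :: "'a::euclidean_space \<Rightarrow> 'a"
  assumes cont: "continuous_on UNIV f" and inj: "inj f"
    and proper: "\<And>M. bounded {z. norm (f z) \<le> M}"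
  shows "\<exists>g. homeomorphism UNIV UNIV f g"
proof -
  obtain g where g: "homeomorphism UNIV (range f) f g"
    by (rule invariance_of_domain_homeomorphism[OF open_UNIV cont _ inj]) auto
  have "open (range f)"
    by (rule invariance_of_domain[OF cont open_UNIV inj])
  moreover have "l \<in> range f" if w: "\<forall>n. w n \<in> range f" and lim: "w \<longlonglongrightarrow> l" for w l
  proof -
    from w have "\<forall>n. \<exists>z. w n = f z" by blast
    then obtain z where z: "\<And>n. w n = f (z n)" by metis
    obtain M where M: "\<And>n. norm (w n) \<le> M"
      using convergent_imp_Bseq[of w] lim by (auto simp: convergent_def Bseq_def)
    have "bounded (range z)"
      by (rule bounded_subset[OF proper[of M]]) (use M z in auto)
    from bounded_imp_convergent_subsequence[OF this] obtain k r
      where r: "strict_mono r" and k: "(z \<circ> r) \<longlonglongrightarrow> k" by auto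
    have "(\<lambda>n. f ((z \<circ> r) n)) \<longlonglongrightarrow> f k"
      using cont k by (rule continuous_on_tendsto_compose) auto
    moreover have "(\<lambda>n. f ((z \<circ> r) n)) \<longlonglongrightarrow> l"
      using LIMSEQ_subseq_LIMSEQ[OF lim r] by (simp add: o_def z)
    ultimately have "l = f k" by (rule LIMSEQ_unique[symmetric])
    thus "l \<in> range f" by blast
  qed
  hence "closed (range f)" unfolding closed_sequential_limits by blast
  ultimately have "range f = UNIV" using clopen[of "range f"] by auto
  thus ?thesis using g by auto
qed

lemma homeomorphism_beurling_ahlfors:
  assumes h: "increasing_homeomorphism h"
  shows "\<exists>G. homeomorphism UNIV UNIV (beurling_ahlfors h) G"
  by (intro homeomorphism_of_proper_injection continuous_on_symmetrize continuous_on_forward_mean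
      increasing_homeomorphismD[OF h] inj_symmetrize separately_increasing_forward_mean h
      bounded_beurling_ahlfors_vimage)

lemma sgn_Im_beurling_ahlfors:
  assumes h: "increasing_homeomorphism h"
  shows "sgn (Im (beurling_ahlfors h z)) = sgn (Im z)"
proof -
  have pos: "Im (beurling_ahlfors h (Complex x y)) > 0" if "y > 0" for x y
    using forward_mean_between[OF h that, of x] unfolding symmetrize_def cnj_Complex by simp
  consider "Im z = 0" | "Im z > 0" | "Im z < 0" by linarith
  thus ?thesis
  proof cases
    case 1 thus ?thesis by (simp add: symmetrize_def)
  next
    case 2 thus ?thesis using pos[of "Im z" "Re z"] by simp
  next
    case 3
    have "cnj z = Complex (Re z) (- Im z)" by (simp add: complex_eq_iff)
    thus ?thesis using 3 pos[of "- Im z" "Re z"] symmetrize_cnj[of "forward_mean h" z] by simp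
  qed
qed

lemma homeomorphism_restrict_vimage:
  assumes "homeomorphism UNIV UNIV f g" "\<And>x. f x \<in> S \<longleftrightarrow> x \<in> S"
  shows "homeomorphism S S f g"
proof -
  have "f ` S = S"
    using assms by (auto simp: homeomorphism_def image_iff) (metis UNIV_I)
  thus ?thesis using homeomorphism_of_subsets[OF assms(1), of S S] by auto
qed

lemma homeomorphic_extension_beurling_ahlfors:
  assumes h: "increasing_homeomorphism h"
  shows "homeomorphic_extension h (beurling_ahlfors h)"
    "\<exists>G. homeomorphism upper_half_plane upper_half_plane (beurling_ahlfors h) G"
proof -
  let ?H = "beurling_ahlfors h"
  obtain G where G: "homeomorphism UNIV UNIV ?H G"
    using homeomorphism_beurling_ahlfors[OF h] by blast
  have "?H z \<in> upper_half_plane \<longleftrightarrow> z \<in> upper_half_plane"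
    "?H z \<in> closed_upper_half_plane \<longleftrightarrow> z \<in> closed_upper_half_plane" for z
    using sgn_Im_beurling_ahlfors[OF h, of z]
    by (auto simp: upper_half_plane_def closed_upper_half_plane_def sgn_if split: if_splits)
  hence *: "homeomorphism upper_half_plane upper_half_plane ?H G"
    "homeomorphism closed_upper_half_plane closed_upper_half_plane ?H G"
    by (auto intro!: homeomorphism_restrict_vimage[OF G])
  thus "\<exists>G. homeomorphism upper_half_plane upper_half_plane ?H G" by blast
  have "\<forall>x. ?H (complex_of_real x) = complex_of_real (h x)"
    by (simp add: symmetrize_def complex_eq_iff)
  thus "homeomorphic_extension h ?H"
    unfolding homeomorphic_extension_def using *(2) homeomorphism_image1[OF *(1)] by blast
qed

section \<open>Differentials\<close>

text \<open>
  The differential of the symmetrization in terms of that of $A$; the inner \<open>cnj w\<close> is the chain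
  rule for the reflection.
\<close>

definition symmetrize_deriv ::
    "(complex \<Rightarrow> complex \<Rightarrow> real) \<Rightarrow> complex \<Rightarrow> complex \<Rightarrow> complex" where
  "symmetrize_deriv A' z w =
     Complex ((A' z w + A' (cnj z) (cnj w)) / 2) ((A' z w - A' (cnj z) (cnj w)) / 2)"

text \<open>
  With an antiderivative $P$ of $h$ the mean is $(P(x+y)-P(x))/y$, and this is its differential with
  $P$ eliminated.  On the real axis the division by zero makes it the zero map, so it is linear at
  every point of the plane.
\<close>

definition forward_mean_deriv :: "(real \<Rightarrow> real) \<Rightarrow> complex \<Rightarrow> complex \<Rightarrow> real" where
  "forward_mean_deriv h z w =
     (Re w * (h (Re z + Im z) - h (Re z)) + Im w * (h (Re z + Im z) - forward_mean h z)) / Im z"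

abbreviation beurling_ahlfors_deriv where
  "beurling_ahlfors_deriv h \<equiv> symmetrize_deriv (forward_mean_deriv h)"

lemma has_derivative_symmetrize:
  assumes "(A has_derivative A' z) (at z)" "(A has_derivative A' (cnj z)) (at (cnj z))"
  shows "(symmetrize A has_derivative symmetrize_deriv A' z) (at z)"
proof -
  have "((\<lambda>z. A (cnj z)) has_derivative (\<lambda>w. A' (cnj z) (cnj w))) (at z)"
    by (rule has_derivative_compose[where f = cnj and g = A and g' = "A' (cnj z)", OF _ assms(2)])
       (rule bounded_linear.has_derivative[OF bounded_linear_cnj], rule has_derivative_ident)
  with assms(1) show ?thesis
    unfolding symmetrize_def[abs_def] symmetrize_deriv_def[abs_def] Complex_eq
    by (auto intro!: derivative_eq_intros simp: field_simps)
qed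

lemma has_derivative_forward_mean:
  assumes h: "continuous_on UNIV h" and z: "Im z \<noteq> 0"
  shows "(forward_mean h has_derivative forward_mean_deriv h z) (at z)"
proof -
  have "\<exists>P. \<forall>x. -\<infinity> < ereal x \<longrightarrow> ereal x < \<infinity> \<longrightarrow> (P has_vector_derivative h x) (at x)"
    by (rule einterval_antiderivative)
       (use h in \<open>auto simp: continuous_on_eq_continuous_at\<close>)
  then obtain P where P: "\<And>x. (P has_real_derivative h x) (at x)"
    by (auto simp: has_real_derivative_iff_has_vector_derivative)
  have mean: "forward_mean h z = (P (Re z + Im z) - P (Re z)) / Im z" if "Im z \<noteq> 0" for z
  proof -
    have "((\<lambda>t. h (Re z + t * Im z)) has_integral
      P (Re z + 1 * Im z) / Im z - P (Re z + 0 * Im z) / Im z) {0..1}"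
    proof (rule fundamental_theorem_of_calculus)
      fix t
      have "((\<lambda>t. P (Re z + t * Im z) / Im z) has_real_derivative h (Re z + t * Im z)) (at t)"
        using that by (auto intro!: derivative_eq_intros DERIV_chain2[OF P])
      thus "((\<lambda>t. P (Re z + t * Im z) / Im z) has_vector_derivative h (Re z + t * Im z))
             (at t within {0..1})"
        by (simp add: has_real_derivative_iff_has_vector_derivative has_vector_derivative_at_within)
    qed simp
    thus ?thesis by (simp add: forward_mean_def integral_unique diff_divide_distrib)
  qed
  have "((\<lambda>z. (P (Re z + Im z) - P (Re z)) / Im z) has_derivative forward_mean_deriv h z) (at z)"
    using z unfolding forward_mean_deriv_def[abs_def] mean[OF z]
    by (auto intro!: derivative_eq_intros DERIV_compose_FDERIV[OF P] simp: field_simps)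
  thus ?thesis
    by (rule has_derivative_transform_within_open[where s = "{z. Im z \<noteq> 0}"])
       (use z in \<open>auto simp: mean open_Collect_neq continuous_intros\<close>)
qed

lemma has_derivative_beurling_ahlfors:
  assumes h: "continuous_on UNIV h" and z: "Im z \<noteq> 0"
  shows "(beurling_ahlfors h has_derivative beurling_ahlfors_deriv h z) (at z)"
  by (intro has_derivative_symmetrize has_derivative_forward_mean assms) (use z in auto)

lemma linear_beurling_ahlfors_deriv: "linear (beurling_ahlfors_deriv h z)"
  by (rule linearI)
     (simp_all add: symmetrize_deriv_def forward_mean_deriv_def complex_eq_iff
       add_divide_distrib diff_divide_distrib algebra_simps)

lemma continuous_on_beurling_ahlfors_deriv:
  assumes h: "continuous_on UNIV h"
  shows "continuous_on {z. Im z \<noteq> 0} (\<lambda>z. beurling_ahlfors_deriv h z w)"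
  unfolding symmetrize_deriv_def forward_mean_deriv_def Complex_eq
  by (intro continuous_intros continuous_on_compose2[OF h]
      continuous_on_compose2[OF continuous_on_forward_mean[OF h]]) auto

section \<open>Weak derivatives of continuously differentiable maps\<close>

text \<open>
  By translation invariance of Lebesgue measure every difference quotient of a compactly supported
  function has integral zero.  The quotients are bounded by the supremum of the directional
  derivative and vanish outside a fixed ball, so dominated convergence passes this on to the
  derivative.
\<close>

lemma integral_directional_derivative_eq_0:
  fixes F :: "'a::euclidean_space \<Rightarrow> 'b::euclidean_space"
  assumes der: "\<And>z. (F has_derivative F' z) (at z)"
    and K: "compact K" and cont: "continuous_on K (\<lambda>z. F' z v)"
    and supp: "\<And>z. z \<notin> K \<Longrightarrow> F z = 0" "\<And>z. z \<notin> K \<Longrightarrow> F' z v = 0"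
  shows "(\<integral>z. F' z v \<partial>lborel) = 0"
proof -
  have contF: "continuous_on S F" for S
    using der by (meson continuous_at_imp_continuous_on has_derivative_continuous)
  have on_K: "(\<lambda>z. indicator K z *\<^sub>R g z) = g" if "\<And>z. z \<notin> K \<Longrightarrow> g z = 0" for g :: "'a \<Rightarrow> 'b"
    using that by (auto simp: indicator_def fun_eq_iff)
  have intF: "integrable lborel F" and intF': "integrable lborel (\<lambda>z. F' z v)"
    using borel_integrable_compact[OF K contF] borel_integrable_compact[OF K cont]
    by (simp_all add: on_K supp)
  obtain B where B: "\<And>z. norm (F' z v) \<le> B" and "B \<ge> 0"
  proof -
    obtain B where "B > 0" "\<And>z. z \<in> K \<Longrightarrow> norm (F' z v) \<le> B"
      using compact_imp_bounded[OF compact_continuous_image[OF cont K]]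
      by (auto simp: bounded_pos)
    thus thesis using that[of B] supp(2) by (metis less_imp_le norm_zero)
  qed
  obtain R where R: "\<And>z. z \<in> K \<Longrightarrow> norm z \<le> R"
    using compact_imp_bounded[OF K] by (auto simp: bounded_iff)
  define \<epsilon> where "\<epsilon> n = inverse (real (Suc n))" for n
  have \<epsilon>: "0 < \<epsilon> n" "\<epsilon> n \<le> 1" for n by (auto simp: \<epsilon>_def inverse_le_1_iff)
  define q where "q n z = inverse (\<epsilon> n) *\<^sub>R (F (\<epsilon> n *\<^sub>R v + z) - F z)" for n z
  have lip: "norm (F (s *\<^sub>R v + z) - F z) \<le> B * s" if "0 \<le> s" for s z
  proof -
    have "norm (F (s *\<^sub>R v + z) - F (0 *\<^sub>R v + z)) \<le> B * norm (s - 0)"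
    proof (rule differentiable_bound[of UNIV])
      fix t
      have "((\<lambda>t. F (t *\<^sub>R v + z)) has_derivative (\<lambda>h. F' (t *\<^sub>R v + z) (h *\<^sub>R v))) (at t)"
        by (rule has_derivative_compose[OF _ der]) (auto intro!: derivative_eq_intros)
      thus "((\<lambda>t. F (t *\<^sub>R v + z)) has_derivative (\<lambda>h. F' (t *\<^sub>R v + z) (h *\<^sub>R v))) (at t within UNIV)"
        by simp
      have "linear (F' (t *\<^sub>R v + z))" by (rule has_derivative_linear[OF der])
      thus "onorm (\<lambda>h. F' (t *\<^sub>R v + z) (h *\<^sub>R v)) \<le> B"
        using B[of "t *\<^sub>R v + z"]
        by (intro onorm_le) (simp add: linear_cmul mult_left_mono mult.commute[of B])
    qed auto
    thus ?thesis using that by simp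
  qed
  have q0: "(\<integral>z. q n z \<partial>lborel) = 0" and qm: "q n \<in> borel_measurable lborel" for n
  proof -
    have *: "integrable lborel (\<lambda>z. F (\<epsilon> n *\<^sub>R v + z))"
      "(\<integral>z. F (\<epsilon> n *\<^sub>R v + z) \<partial>lborel) = (\<integral>z. F z \<partial>lborel)"
      using intF integrable_distr_eq[of "(+) (\<epsilon> n *\<^sub>R v)" lborel borel F]
        integral_distr[of "(+) (\<epsilon> n *\<^sub>R v)" lborel borel F] lborel_distr_plus[of "\<epsilon> n *\<^sub>R v"]
      by simp_all
    show "(\<integral>z. q n z \<partial>lborel) = 0"
      unfolding q_def using * intF by simp
    show "q n \<in> borel_measurable lborel"
      unfolding q_def[abs_def] using * intF by (intro borel_measurable_integrable) auto
  qed
  have "(\<lambda>n. \<integral>z. q n z \<partial>lborel) \<longlonglongrightarrow> (\<integral>z. F' z v \<partial>lborel)"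
  proof (rule integral_dominated_convergence[where w = "\<lambda>z. indicator (cball 0 (R + norm v)) z *\<^sub>R B"])
    show "(\<lambda>z. F' z v) \<in> borel_measurable lborel" using intF' by simp
    show "integrable lborel (\<lambda>z. indicator (cball 0 (R + norm v)) z *\<^sub>R B :: real)"
      by (intro borel_integrable_compact continuous_intros) auto
    show "AE z in lborel. (\<lambda>n. q n z) \<longlonglongrightarrow> F' z v"
    proof (intro AE_I2)
      fix z
      have "((\<lambda>t. F (t *\<^sub>R v + z)) has_derivative (\<lambda>h. F' (0 *\<^sub>R v + z) (h *\<^sub>R v))) (at 0)"
        by (rule has_derivative_compose[OF _ der]) (auto intro!: derivative_eq_intros)
      hence "((\<lambda>h. norm (F (h *\<^sub>R v + z) - F z - h *\<^sub>R F' z v) / norm h) \<longlongrightarrow> 0) (at 0)"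
        using linear_cmul[OF has_derivative_linear[OF der[of z]]]
        by (simp add: has_derivative_iff_norm)
      moreover have "\<forall>\<^sub>F h in at 0. norm (F (h *\<^sub>R v + z) - F z - h *\<^sub>R F' z v) / norm h =
          norm (inverse h *\<^sub>R (F (h *\<^sub>R v + z) - F z) - F' z v)"
      proof (rule eventually_at_ball'[THEN eventually_mono])
        fix h :: real assume "h \<in> ball 0 1 \<and> h \<noteq> 0 \<and> h \<in> UNIV"
        hence eq: "inverse h *\<^sub>R (F (h *\<^sub>R v + z) - F z) - F' z v =
            inverse h *\<^sub>R (F (h *\<^sub>R v + z) - F z - h *\<^sub>R F' z v)"
          by (simp add: scaleR_diff_right)
        show "norm (F (h *\<^sub>R v + z) - F z - h *\<^sub>R F' z v) / norm h =
          norm (inverse h *\<^sub>R (F (h *\<^sub>R v + z) - F z) - F' z v)"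
          unfolding eq norm_scaleR by (simp add: divide_inverse)
      qed simp
      ultimately have "((\<lambda>h. norm (inverse h *\<^sub>R (F (h *\<^sub>R v + z) - F z) - F' z v)) \<longlongrightarrow> 0) (at 0)"
        by (rule Lim_transform_eventually)
      hence "((\<lambda>h. inverse h *\<^sub>R (F (h *\<^sub>R v + z) - F z)) \<longlongrightarrow> F' z v) (at 0)"
        by (simp only: tendsto_norm_zero_iff LIM_zero_iff)
      moreover have "filterlim \<epsilon> (at 0) sequentially"
        unfolding filterlim_at \<epsilon>_def using LIMSEQ_inverse_real_of_nat by auto
      ultimately show "(\<lambda>n. q n z) \<longlonglongrightarrow> F' z v"
        unfolding q_def by (rule filterlim_compose)
    qed
    fix n
    show "AE z in lborel. norm (q n z) \<le> indicator (cball 0 (R + norm v)) z *\<^sub>R B"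
    proof (intro AE_I2)
      fix z
      have "q n z = 0" if "z \<notin> cball 0 (R + norm v)"
      proof -
        have "norm z \<le> norm (\<epsilon> n *\<^sub>R v + z) + norm (\<epsilon> n *\<^sub>R v)"
          using norm_triangle_ineq4[of "\<epsilon> n *\<^sub>R v + z" "\<epsilon> n *\<^sub>R v"] by simp
        moreover have "norm (\<epsilon> n *\<^sub>R v) \<le> norm v"
          using \<epsilon>[of n] by (simp add: mult_left_le_one_le)
        ultimately have "norm (\<epsilon> n *\<^sub>R v + z) > R" "norm z > R"
          using that norm_ge_zero[of v] by (auto simp del: norm_ge_zero)
        hence "\<epsilon> n *\<^sub>R v + z \<notin> K" "z \<notin> K" using R by force+
        thus ?thesis by (simp add: q_def supp)
      qed
      moreover have "norm (q n z) \<le> B"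
        using lip[of "\<epsilon> n" z] \<epsilon>[of n] unfolding q_def norm_scaleR
        by (simp add: inverse_eq_divide pos_divide_le_eq)
      ultimately show "norm (q n z) \<le> indicator (cball 0 (R + norm v)) z *\<^sub>R B"
        by (cases "z \<in> cball 0 (R + norm v)") auto
    qed
  qed (rule qm)
  thus ?thesis using LIMSEQ_unique[OF tendsto_const] by (fastforce simp: q0)
qed

lemma integrable_indicator_of_support:
  fixes g :: "'a::euclidean_space \<Rightarrow> 'b::euclidean_space"
  assumes "compact S" "S \<subseteq> U" "continuous_on S g" "\<And>z. z \<in> U - S \<Longrightarrow> g z = 0"
  shows "integrable lborel (\<lambda>z. indicator U z *\<^sub>R g z)"
proof -
  have "(\<lambda>z. indicator U z *\<^sub>R g z) = (\<lambda>z. indicator S z *\<^sub>R g z)"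
    using assms(2,4) by (auto simp: indicator_def fun_eq_iff)
  thus ?thesis using borel_integrable_compact[OF assms(1,3)] by simp
qed

text \<open>
  Integration by parts is the vanishing of the integral of the derivative of the product \<open>\<phi> f\<close>,
  continued by zero outside U.
\<close>

lemma has_weak_directional_derivative_of_C1:
  assumes U: "open U" and der: "\<And>z. z \<in> U \<Longrightarrow> (f has_derivative f' z) (at z)"
    and cont: "continuous_on U (\<lambda>z. f' z v)"
  shows "has_weak_directional_derivative U v f (\<lambda>z. f' z v)"
  unfolding has_weak_directional_derivative_def
proof (intro allI impI)
  fix \<phi> assume \<phi>: "test_function U \<phi>"
  define S where "S = closure {z. \<phi> z \<noteq> 0}"
  define \<phi>' where "\<phi>' z = frechet_derivative \<phi> (at z)" for z
  have S: "compact S" "S \<subseteq> U" using \<phi> by (auto simp: test_function_def S_def)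
  have C1: "C_k (Suc 0) \<phi>" using \<phi> by (simp only: test_function_def)
  hence der\<phi>: "(\<phi> has_derivative \<phi>' z) (at z)" for z
    unfolding \<phi>'_def by (simp add: differentiable_on_def frechet_derivative_works)
  have cont\<phi>': "continuous_on T (\<lambda>z. \<phi>' z v)" for T
    unfolding \<phi>'_def using C1 by (auto intro: continuous_on_subset)
  have cont\<phi>: "continuous_on T \<phi>" for T
    using der\<phi> by (meson continuous_at_imp_continuous_on has_derivative_continuous)
  have contf: "continuous_on S f"
    using der S by (meson continuous_at_imp_continuous_on has_derivative_continuous subsetD)
  have contf': "continuous_on S (\<lambda>z. f' z v)"
    using cont S continuous_on_subset by blast
  have \<phi>0: "\<phi> z = 0" if "z \<notin> S" for z
    using that closure_subset[of "{z. \<phi> z \<noteq> 0}"] unfolding S_def by blast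
  have openS: "open (- S)" using S compact_imp_closed by blast
  have local0: "(g has_derivative (\<lambda>_. 0)) (at z)"
    if "z \<notin> S" "\<And>z. z \<notin> S \<Longrightarrow> g z = 0" for z and g :: "complex \<Rightarrow> 'b::real_normed_vector"
    by (rule has_derivative_transform_within_open[OF has_derivative_const[of 0] openS])
       (use that in auto)
  have \<phi>'0: "\<phi>' z = (\<lambda>_. 0)" if "z \<notin> S" for z
    using has_derivative_unique[OF der\<phi> local0[OF that \<phi>0]] .
  let ?g1 = "\<lambda>z. indicator U z *\<^sub>R (\<phi>' z v *\<^sub>R f z)"
  let ?g2 = "\<lambda>z. indicator U z *\<^sub>R (\<phi> z *\<^sub>R f' z v)"
  have int1: "integrable lborel ?g1"
    by (rule integrable_indicator_of_support[OF S])
       (auto intro!: continuous_intros cont\<phi>' contf simp: \<phi>'0)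
  have int2: "integrable lborel ?g2"
    by (rule integrable_indicator_of_support[OF S])
       (auto intro!: continuous_intros cont\<phi> contf' simp: \<phi>0)
  define F where "F z = \<phi> z *\<^sub>R f z" for z
  define F' where "F' z w = (if z \<in> U then \<phi> z *\<^sub>R f' z w + \<phi>' z w *\<^sub>R f z else 0)" for z w
  have "(\<integral>z. F' z v \<partial>lborel) = 0"
  proof (rule integral_directional_derivative_eq_0[OF _ S(1)])
    show "(F has_derivative F' z) (at z)" for z
    proof (cases "z \<in> U")
      case True
      thus ?thesis
        using has_derivative_scaleR[OF der\<phi> der[OF True]] by (simp add: F_def[abs_def] F'_def[abs_def])
    next
      case False
      thus ?thesis using local0[of z F] S(2) by (auto simp: F'_def[abs_def] F_def \<phi>0)
    qed
    have "continuous_on S (\<lambda>z. \<phi> z *\<^sub>R f' z v + \<phi>' z v *\<^sub>R f z)"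
      by (intro continuous_intros cont\<phi> cont\<phi>' contf contf')
    thus "continuous_on S (\<lambda>z. F' z v)"
      by (rule continuous_on_eq) (use S in \<open>auto simp: F'_def\<close>)
  qed (auto simp: F_def F'_def \<phi>0 \<phi>'0)
  also have "(\<lambda>z. F' z v) = (\<lambda>z. ?g1 z + ?g2 z)"
    by (auto simp: F'_def indicator_def fun_eq_iff)
  also have "(\<integral>z. ?g1 z + ?g2 z \<partial>lborel) = (\<integral>z. ?g1 z \<partial>lborel) + (\<integral>z. ?g2 z \<partial>lborel)"
    by (rule Bochner_Integration.integral_add[OF int1 int2])
  finally have "(\<integral>z. ?g1 z \<partial>lborel) = - (\<integral>z. ?g2 z \<partial>lborel)"
    by (simp add: eq_neg_iff_add_eq_0)
  thus "(LINT z:U|lebesgue. frechet_derivative \<phi> (at z) v *\<^sub>R f z) = - (LINT z:U|lebesgue. \<phi> z *\<^sub>R f' z v)"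
    using int1 int2 unfolding set_lebesgue_integral_def \<phi>'_def[symmetric]
    by (simp add: integral_completion)
qed

lemma locally_integrable_on_of_continuous:
  fixes f :: "complex \<Rightarrow> 'b::euclidean_space"
  assumes "continuous_on U f"
  shows "f locally_integrable_on U"
  unfolding locally_integrable_on_def set_integrable_def
  by (auto intro!: integrable_completion[THEN iffD2] borel_integrable_compact
      borel_measurable_integrable intro: continuous_on_subset[OF assms])

lemma W11_loc_with_of_C1:
  assumes U: "open U" and der: "\<And>z. z \<in> U \<Longrightarrow> (f has_derivative f' z) (at z)"
    and cont: "\<And>v. continuous_on U (\<lambda>z. f' z v)" and lin: "\<And>z. linear (f' z)"
  shows "W11_loc_with U f f'"
proof -
  have "continuous_on U f"
    using der by (meson continuous_at_imp_continuous_on has_derivative_continuous)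
  thus ?thesis
    unfolding W11_loc_with_def
    using lin has_weak_directional_derivative_of_C1[OF U der cont] cont
    by (auto intro!: locally_integrable_on_of_continuous)
qed

section \<open>A linear bound for the dilatation\<close>

lemma dilatation_le:
  assumes "1 \<le> K" "(onorm L)\<^sup>2 \<le> K * jacobian L"
  shows "dilatation L \<le> ennreal K"
  unfolding dilatation_def using assms by (auto intro!: INF_lower2)

lemma jacobian_eq: "jacobian L = Re (L 1) * Im (L \<i>) - Re (L \<i>) * Im (L 1)"
  by (simp add: jacobian_def det_2)

text \<open>
  The Hilbert-Schmidt norm dominates the operator norm.
\<close>

lemma onorm_power2_le:
  assumes "linear (L :: complex \<Rightarrow> complex)"
  shows "(onorm L)\<^sup>2 \<le> (norm (L 1))\<^sup>2 + (norm (L \<i>))\<^sup>2"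
proof -
  let ?c = "sqrt ((norm (L 1))\<^sup>2 + (norm (L \<i>))\<^sup>2)"
  have "norm (L w) \<le> ?c * norm w" for w
  proof -
    have "w = Re w *\<^sub>R 1 + Im w *\<^sub>R \<i>"
      by (simp add: complex_eq_iff)
    hence "L w = L (Re w *\<^sub>R 1 + Im w *\<^sub>R \<i>)" by (rule arg_cong)
    also have "\<dots> = Re w *\<^sub>R L 1 + Im w *\<^sub>R L \<i>"
      using assms by (simp only: linear_add linear_cmul)
    finally have "norm (L w) \<le> \<bar>Re w\<bar> * norm (L 1) + \<bar>Im w\<bar> * norm (L \<i>)"
      using norm_triangle_ineq[of "Re w *\<^sub>R L 1" "Im w *\<^sub>R L \<i>"] by simp
    also have "\<dots> \<le> ?c * norm w"
      using Cauchy_Schwarz_ineq2[of "(\<bar>Re w\<bar>, \<bar>Im w\<bar>)" "(norm (L 1), norm (L \<i>))"]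
      by (simp add: norm_prod_def cmod_def mult.commute)
    finally show ?thesis .
  qed
  hence "onorm L \<le> ?c" by (intro onorm_le)
  hence "(onorm L)\<^sup>2 \<le> ?c\<^sup>2"
    using onorm_pos_le[of L] assms by (intro power_mono) (auto simp: linear_conv_bounded_linear)
  thus ?thesis by simp
qed

text \<open>
  Think of $p$ and $q$ as the increments of $h$ over $[x,x+y]$ and $[x-y,x]$, and of $p'$ and $q'$ as the
  distances of the two means from $h(x+y)$ and $h(x-y)$.  Up to a common factor the left side is the
  squared Hilbert-Schmidt norm of the differential of the extension and $pq'+qp'$ is its Jacobian.  Let $q$ be the
  larger increment.  If $q'$ is comparable with $q$, then the ratio $q/p$ alone controls the
  quotient.  If $q'$ is small, then the quotient is controlled by $q/p'$, and this is where the second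
  pair of hypotheses comes in: most of the increment $q$ is then gained close to $x$, so a second
  symmetric distortion is at least a multiple of $q/p'$.  The bound is linear in $R$ because in each
  case a single distortion is used instead of a product of two.
\<close>

lemma increment_inequality:
  fixes p q p' q' R :: real
  assumes p: "0 < p'" "p' \<le> p" and q: "0 < q'" "q' \<le> q"
    and R: "q \<le> R * p" "p \<le> R * q"
    and R': "q - 4 * q' \<le> R * (4 * p')" "p - 4 * p' \<le> R * (4 * q')"
  shows "p\<^sup>2 + q\<^sup>2 + p'\<^sup>2 + q'\<^sup>2 \<le> 64 * R * (p * q' + q * p')"
proof -
  have main: "p\<^sup>2 + q\<^sup>2 + p'\<^sup>2 + q'\<^sup>2 \<le> 64 * R * (p * q' + q * p')"
    if p: "0 < p'" "p' \<le> p" and q: "0 < q'" "q' \<le> q" and "p \<le> q"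
      and R: "q \<le> R * p" and R': "q - 4 * q' \<le> R * (4 * p')" for p q p' q' :: real
  proof -
    have sq: "a\<^sup>2 \<le> q\<^sup>2" if "0 < a" "a \<le> q" for a using that by (intro power_mono) auto
    have "0 < R * p" using p q R by linarith
    hence "R > 0" using p by (simp add: zero_less_mult_iff)
    have "p\<^sup>2 + q\<^sup>2 + p'\<^sup>2 + q'\<^sup>2 \<le> 4 * q\<^sup>2"
      using sq[of p] sq[of p'] sq[of q'] p q \<open>p \<le> q\<close> by linarith
    also have "\<dots> \<le> 64 * R * (p * q' + q * p')"
    proof (cases "q' \<ge> q / 16")
      case True
      have "q * (q / 16) \<le> (R * p) * q'"
        using R True p q \<open>R > 0\<close> by (intro mult_mono) auto
      moreover have "0 \<le> R * (q * p')" using p q \<open>R > 0\<close> by simp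
      ultimately show ?thesis by (simp add: algebra_simps power2_eq_square)
    next
      case False
      hence "q * (3 * q / 4) \<le> q * (R * (4 * p'))"
        using R' q by (intro mult_left_mono) auto
      hence "3 * q\<^sup>2 \<le> 16 * (R * (q * p'))" by (simp add: algebra_simps power2_eq_square)
      moreover have "0 \<le> R * (p * q')" using p q \<open>R > 0\<close> by simp
      moreover have "0 \<le> q\<^sup>2" by simp
      ultimately have "4 * q\<^sup>2 \<le> 64 * (R * (p * q')) + 64 * (R * (q * p'))" by linarith
      thus ?thesis by (simp add: distrib_left)
    qed
    finally show ?thesis .
  qed
  show ?thesis
  proof (cases "p \<le> q")
    case True thus ?thesis using main[of p' p q' q] assms by blast
  next
    case False thus ?thesis using main[of q' q p' p] assms by (simp add: algebra_simps)
  qed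
qed

lemma symmetric_distortion_ge:
  assumes h: "strict_mono h" and t: "t > 0"
  shows "h (x + t) - h x \<le> symmetric_distortion h x t * (h x - h (x - t))"
    "h x - h (x - t) \<le> symmetric_distortion h x t * (h (x + t) - h x)"
    "1 \<le> symmetric_distortion h x t"
proof -
  have pos: "0 < h (x + t) - h x" "0 < h x - h (x - t)"
    using strict_monoD[OF h] t by simp_all
  have 1: "(h (x + t) - h x) / (h x - h (x - t)) \<le> symmetric_distortion h x t"
    "(h x - h (x - t)) / (h (x + t) - h x) \<le> symmetric_distortion h x t"
    using pos unfolding symmetric_distortion_def by simp_all
  show 2: "h (x + t) - h x \<le> symmetric_distortion h x t * (h x - h (x - t))"
    "h x - h (x - t) \<le> symmetric_distortion h x t * (h (x + t) - h x)"
    using 1 pos by (simp_all only: pos_divide_le_eq)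
  show "1 \<le> symmetric_distortion h x t"
  proof (cases "h (x + t) - h x \<le> h x - h (x - t)")
    case True
    thus ?thesis using pos by (intro order_trans[OF _ 1(2)]) simp
  next
    case False
    thus ?thesis using pos by (intro order_trans[OF _ 1(1)]) simp
  qed
qed

text \<open>
  The symmetric intervals about $x\pm y/4$ of radius $y/2$ have $x$ in the interior of one half and
  stay within $[x-y,x+y]$.  For the one about $x+y/4$, the increment of $h$ over the half containing
  $x$ is at least $h(x)-h(x-y/4)$, which is nearly all of $h(x)-h(x-y)$ if $h$ rises steeply just to the
  left of $x$.  The other half lies in $[x+y/4,x+y]$, over which $h$ increases by at most four times
  the difference of $h(x+y)$ and the forward mean.  The one about $x-y/4$ is its mirror image.
\<close>

lemma dilatation_beurling_ahlfors_le:
  fixes x y :: real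
  assumes h: "increasing_homeomorphism h" and y: "y > 0"
  defines "R \<equiv> max (symmetric_distortion h x y)
     (max (symmetric_distortion h (x + y/4) (y/2)) (symmetric_distortion h (x - y/4) (y/2)))"
  shows "dilatation (beurling_ahlfors_deriv h (Complex x y)) \<le> ennreal (64 * R)"
    "jacobian (beurling_ahlfors_deriv h (Complex x y)) > 0"
proof -
  note h' = increasing_homeomorphismD[OF h]
  let ?L = "beurling_ahlfors_deriv h (Complex x y)"
  define p where "p = h (x + y) - h x"
  define q where "q = h x - h (x - y)"
  define p' where "p' = h (x + y) - forward_mean h (Complex x y)"
  define q' where "q' = forward_mean h (Complex x (-y)) - h (x - y)"
  have pos: "0 < p'" "p' \<le> p" "0 < q'" "q' \<le> q"
    using forward_mean_between[OF h y, of x] by (auto simp: p_def q_def p'_def q'_def)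
  have R: "symmetric_distortion h x y \<le> R" "symmetric_distortion h (x + y/4) (y/2) \<le> R"
      "symmetric_distortion h (x - y/4) (y/2) \<le> R"
    by (auto simp: R_def)
  have R1: "R \<ge> 1" using symmetric_distortion_ge(3)[OF h'(1) y, of x] R(1) by linarith
  have L1: "?L 1 = Complex ((p + q) / (2 * y)) ((p - q) / (2 * y))"
    and Li: "?L \<i> = Complex ((p' - q') / (2 * y)) ((p' + q') / (2 * y))"
    using y by (simp_all add: symmetrize_deriv_def forward_mean_deriv_def cnj_Complex
        p_def q_def p'_def q'_def field_simps)
  have J: "jacobian ?L = (p * q' + q * p') / (2 * y\<^sup>2)"
    using y unfolding jacobian_eq L1 Li by (simp add: field_simps power2_eq_square)
  show "jacobian ?L > 0" unfolding J using pos y by (intro divide_pos_pos add_pos_pos mult_pos_pos) auto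
  have "q \<le> R * p" "p \<le> R * q"
    using symmetric_distortion_ge(1,2)[OF h'(1) y, of x] pos
      mult_right_mono[OF R(1), of p] mult_right_mono[OF R(1), of q]
    unfolding p_def q_def by linarith+
  moreover have "q - 4 * q' \<le> R * (4 * p')"
  proof -
    have "q - 4 * q' \<le> h x - h (x - y/4)"
      using forward_mean_quarter(3)[OF h, of y x] y unfolding q_def q'_def by simp
    also have "\<dots> \<le> h (x + y/4) - h (x + y/4 - y/2)"
      using y by (simp add: strict_mono_less_eq[OF h'(1)])
    also have "\<dots> \<le> symmetric_distortion h (x + y/4) (y/2) * (h (x + y/4 + y/2) - h (x + y/4))"
      by (rule symmetric_distortion_ge(2)[OF h'(1)]) (use y in simp)
    also have "\<dots> \<le> R * (h (x + y) - h (x + y/4))"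
      using R R1 y by (intro mult_mono) (auto simp: strict_mono_less_eq[OF h'(1)])
    also have "\<dots> \<le> R * (4 * p')"
      using forward_mean_quarter(2)[OF h, of y x] y R1 unfolding p'_def by (intro mult_left_mono) auto
    finally show ?thesis .
  qed
  moreover have "p - 4 * p' \<le> R * (4 * q')"
  proof -
    have "p - 4 * p' \<le> h (x + y/4) - h x"
      using forward_mean_quarter(2)[OF h, of y x] y unfolding p_def p'_def by simp
    also have "\<dots> \<le> h (x - y/4 + y/2) - h (x - y/4)"
      using y by (simp add: strict_mono_less_eq[OF h'(1)] add.commute)
    also have "\<dots> \<le> symmetric_distortion h (x - y/4) (y/2) * (h (x - y/4) - h (x - y/4 - y/2))"
      by (rule symmetric_distortion_ge(1)[OF h'(1)]) (use y in simp)
    also have "\<dots> \<le> R * (h (x - y/4) - h (x - y))"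
      using R R1 y by (intro mult_mono) (auto simp: strict_mono_less_eq[OF h'(1)])
    also have "\<dots> \<le> R * (4 * q')"
      using forward_mean_quarter(3)[OF h, of y x] y R1 unfolding q'_def by (intro mult_left_mono) auto
    finally show ?thesis .
  qed
  ultimately have *: "p\<^sup>2 + q\<^sup>2 + p'\<^sup>2 + q'\<^sup>2 \<le> 64 * R * (p * q' + q * p')"
    by (intro increment_inequality pos)
  have "(onorm ?L)\<^sup>2 \<le> (norm (?L 1))\<^sup>2 + (norm (?L \<i>))\<^sup>2"
    by (rule onorm_power2_le[OF linear_beurling_ahlfors_deriv])
  also have "\<dots> = (p\<^sup>2 + q\<^sup>2 + p'\<^sup>2 + q'\<^sup>2) / (2 * y\<^sup>2)"
    using y unfolding L1 Li cmod_power2 by (simp add: field_simps power2_eq_square)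
  also have "\<dots> \<le> 64 * R * (p * q' + q * p') / (2 * y\<^sup>2)"
    using * by (rule divide_right_mono) simp
  also have "\<dots> = (64 * R) * jacobian ?L" by (simp add: J)
  finally show "dilatation ?L \<le> ennreal (64 * R)"
    using R1 by (intro dilatation_le) auto
qed

section \<open>Shears and the spherical measure\<close>

lemma measurable_Complex [measurable]:
  "(\<lambda>(y, x). Complex x y) \<in> borel_measurable (lborel \<Otimes>\<^sub>M lborel)"
  unfolding Complex_eq case_prod_beta by measurable

lemma lborel_complex: "(lborel :: complex measure) = distr (lborel \<Otimes>\<^sub>M lborel) borel (\<lambda>(y, x). Complex x y)"
proof (rule lborel_eqI)
  fix l u :: complex
  assume le: "\<And>b. b \<in> Basis \<Longrightarrow> l \<bullet> b \<le> u \<bullet> b"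
  have "(\<lambda>(y, x). Complex x y) -` box l u \<inter> space (lborel \<Otimes>\<^sub>M lborel)
      = {Im l<..<Im u} \<times> {Re l<..<Re u}"
    by (auto simp: box_def Basis_complex_def space_pair_measure)
  thus "emeasure (distr (lborel \<Otimes>\<^sub>M lborel) borel (\<lambda>(y, x). Complex x y)) (box l u)
      = ennreal (\<Prod>b\<in>Basis. (u - l) \<bullet> b)"
    using le[of 1] le[of \<i>]
    by (simp add: emeasure_distr lborel.emeasure_pair_measure_Times Basis_complex_def
        ennreal_mult' mult.commute)
qed simp

lemma nn_integral_complex_iterated:
  assumes [measurable]: "f \<in> borel_measurable borel"
  shows "(\<integral>\<^sup>+z. f z \<partial>lborel) = (\<integral>\<^sup>+y. \<integral>\<^sup>+x. f (Complex x y) \<partial>lborel \<partial>lborel)"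
  by (simp add: lborel_complex nn_integral_distr lborel.nn_integral_fst[symmetric] case_prod_beta)

text \<open>
  For fixed height the shear is a translation, so iterated integration reduces it to a scaling of
  the height.
\<close>

lemma nn_integral_shear:
  fixes f :: "complex \<Rightarrow> ennreal"
  assumes [measurable]: "f \<in> borel_measurable borel" and d: "d \<noteq> 0"
  shows "(\<integral>\<^sup>+z. f z \<partial>lborel) = ennreal \<bar>d\<bar> * (\<integral>\<^sup>+z. f (Complex (Re z + c * Im z) (d * Im z)) \<partial>lborel)"
proof -
  have m[measurable]: "(\<lambda>z. f (Complex (Re z + c * Im z) (d * Im z))) \<in> borel_measurable borel"
    unfolding Complex_eq by measurable
  have [measurable]: "(\<lambda>x. f (Complex x y)) \<in> borel_measurable borel" for y
    unfolding Complex_eq by measurable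
  have [measurable]: "(\<lambda>y. \<integral>\<^sup>+x. f (Complex x y) \<partial>lborel) \<in> borel_measurable borel"
  proof -
    have "(\<lambda>(y, x). f (Complex x y)) \<in> borel_measurable (lborel \<Otimes>\<^sub>M lborel)"
      unfolding Complex_eq by measurable
    from lborel.borel_measurable_nn_integral[OF this] show ?thesis by simp
  qed
  have "(\<integral>\<^sup>+z. f (Complex (Re z + c * Im z) (d * Im z)) \<partial>lborel)
      = (\<integral>\<^sup>+y. \<integral>\<^sup>+x. f (Complex (x + c * y) (d * y)) \<partial>lborel \<partial>lborel)"
    by (simp add: nn_integral_complex_iterated)
  also have "\<dots> = (\<integral>\<^sup>+y. \<integral>\<^sup>+x. f (Complex x (d * y)) \<partial>lborel \<partial>lborel)"
  proof (rule nn_integral_cong)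
    fix y
    show "(\<integral>\<^sup>+x. f (Complex (x + c * y) (d * y)) \<partial>lborel) = (\<integral>\<^sup>+x. f (Complex x (d * y)) \<partial>lborel)"
      using nn_integral_real_affine[of "\<lambda>x. f (Complex x (d * y))" 1 "c * y"] by (simp add: add.commute)
  qed
  finally show ?thesis
    using nn_integral_real_affine[of "\<lambda>y. \<integral>\<^sup>+x. f (Complex x y) \<partial>lborel" d 0] d
    by (simp add: nn_integral_complex_iterated)
qed

lemma nn_integral_spherical_measure:
  assumes [measurable]: "f \<in> borel_measurable borel"
  shows "(\<integral>\<^sup>+z. f z \<partial>spherical_measure)
    = (\<integral>\<^sup>+z. ennreal (4 / (1 + (Re z)\<^sup>2 + (Im z)\<^sup>2)\<^sup>2) * f z \<partial>lborel)"
proof -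
  have 1: "(\<lambda>z::complex. ennreal (4 / (1 + (Re z)\<^sup>2 + (Im z)\<^sup>2)\<^sup>2)) \<in> borel_measurable lborel"
    by measurable
  have 2: "f \<in> borel_measurable lborel" by simp
  show ?thesis
    unfolding spherical_measure_def
    by (subst nn_integral_density[OF measurable_completion[OF 1] measurable_completion[OF 2]])
       (rule nn_integral_completion)
qed

lemma open_upper_half_plane: "open upper_half_plane"
  unfolding upper_half_plane_def by (rule open_halfspace_Im_gt)

text \<open>
  The shear increases $1+|z|^2$ at most by the factor 2 and so decreases the spherical density at most
  by the factor 4; its determinant 1/2 accounts for the remaining factor 2.
\<close>

lemma nn_integral_spherical_shear_le:
  assumes f[measurable]: "f \<in> borel_measurable borel" and c: "\<bar>c\<bar> \<le> 1/4"
  shows "(\<integral>\<^sup>+z\<in>upper_half_plane. f (Complex (Re z + c * Im z) (Im z / 2)) \<partial>spherical_measure)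
     \<le> 8 * (\<integral>\<^sup>+z\<in>upper_half_plane. f z \<partial>spherical_measure)"
proof -
  let ?U = upper_half_plane
  let ?w = "\<lambda>z. 4 / (1 + (Re z)\<^sup>2 + (Im z)\<^sup>2)\<^sup>2"
  let ?S = "\<lambda>z. Complex (Re z + c * Im z) (1/2 * Im z)"
  have [measurable]: "?U \<in> sets borel" using open_upper_half_plane by simp
  have [measurable]: "?S \<in> borel_measurable borel" unfolding Complex_eq by measurable
  have w: "?w z \<le> 4 * ?w (?S z)" for z
  proof -
    let ?x = "Re z" and ?y = "Im z"
    have "c\<^sup>2 \<le> (1/4)\<^sup>2" using c by (simp add: abs_le_square_iff[symmetric])
    hence "c\<^sup>2 * ?y\<^sup>2 \<le> 1/16 * ?y\<^sup>2" by (intro mult_right_mono) (auto simp: power2_eq_square)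
    moreover have "(?x + c * ?y)\<^sup>2 \<le> 2 * ?x\<^sup>2 + 2 * (c\<^sup>2 * ?y\<^sup>2)"
      using zero_le_power2[of "?x - c * ?y"] by (simp add: power2_eq_square algebra_simps)
    moreover have "0 \<le> ?x\<^sup>2" "0 \<le> ?y\<^sup>2" "(1/2 * ?y)\<^sup>2 = ?y\<^sup>2 / 4" by (simp_all add: power_divide)
    moreover have "1 + a + b \<le> 2 * (1 + X + Y)"
      if "e \<le> 1/16 * Y" "a \<le> 2 * X + 2 * e" "0 \<le> X" "0 \<le> Y" "b = Y / 4" for a b e X Y :: real
      using that by simp
    ultimately have "1 + (?x + c * ?y)\<^sup>2 + (1/2 * ?y)\<^sup>2 \<le> 2 * (1 + ?x\<^sup>2 + ?y\<^sup>2)"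
      by blast
    hence "(1 + (?x + c * ?y)\<^sup>2 + (1/2 * ?y)\<^sup>2)\<^sup>2 \<le> (2 * (1 + ?x\<^sup>2 + ?y\<^sup>2))\<^sup>2"
      by (intro power_mono) auto
    moreover have "0 < 1 + (?x + c * ?y)\<^sup>2 + (1/2 * ?y)\<^sup>2"
      by (intro add_pos_nonneg) auto
    ultimately have "16 / (2 * (1 + ?x\<^sup>2 + ?y\<^sup>2))\<^sup>2 \<le> 16 / (1 + (?x + c * ?y)\<^sup>2 + (1/2 * ?y)\<^sup>2)\<^sup>2"
      by (intro divide_left_mono) (auto intro!: mult_pos_pos add_pos_nonneg)
    moreover have "16 / (2 * X)\<^sup>2 = 4 / X\<^sup>2" for X :: real by (simp add: power_mult_distrib)
    ultimately have "4 / (1 + ?x\<^sup>2 + ?y\<^sup>2)\<^sup>2 \<le> 16 / (1 + (?x + c * ?y)\<^sup>2 + (1/2 * ?y)\<^sup>2)\<^sup>2"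
      by (simp only:)
    thus ?thesis by simp
  qed
  have U: "indicator ?U z = (indicator ?U (?S z) :: ennreal)" for z
    by (simp add: indicator_def upper_half_plane_def)
  let ?g = "\<lambda>z. ennreal (?w z) * (f z * indicator ?U z)"
  have "(\<integral>\<^sup>+z\<in>?U. f (?S z) \<partial>spherical_measure) = (\<integral>\<^sup>+z. ennreal (?w z) * (f (?S z) * indicator ?U z) \<partial>lborel)"
    by (rule nn_integral_spherical_measure) measurable
  also have "\<dots> \<le> (\<integral>\<^sup>+z. 4 * ?g (?S z) \<partial>lborel)"
  proof (rule nn_integral_mono)
    fix z
    have "ennreal (?w z) \<le> ennreal (4 * ?w (?S z))" using w by (rule ennreal_leI)
    also have "\<dots> = 4 * ennreal (?w (?S z))" by (subst ennreal_mult) auto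
    finally show "ennreal (?w z) * (f (?S z) * indicator ?U z) \<le> 4 * ?g (?S z)"
      unfolding U[of z] mult.assoc[symmetric] by (intro mult_right_mono) auto
  qed
  also have "\<dots> = 4 * (\<integral>\<^sup>+z. ?g (?S z) \<partial>lborel)"
    by (rule nn_integral_cmult) measurable
  also have "\<dots> = 8 * (ennreal \<bar>1/2\<bar> * (\<integral>\<^sup>+z. ?g (?S z) \<partial>lborel))"
  proof -
    have "ennreal 4 = ennreal (8 * \<bar>1/2\<bar>)" by (rule arg_cong[where f = ennreal]) simp
    also have "\<dots> = ennreal 8 * ennreal \<bar>1/2\<bar>" by (rule ennreal_mult) auto
    finally have "(4::ennreal) = 8 * ennreal \<bar>1/2\<bar>" by (simp only: ennreal_numeral)
    thus ?thesis by (simp only: mult.assoc)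
  qed
  also have "ennreal \<bar>1/2\<bar> * (\<integral>\<^sup>+z. ?g (?S z) \<partial>lborel) = (\<integral>\<^sup>+z. ?g z \<partial>lborel)"
    by (rule nn_integral_shear[symmetric]) auto
  also have "\<dots> = (\<integral>\<^sup>+z\<in>?U. f z \<partial>spherical_measure)"
    by (rule nn_integral_spherical_measure[symmetric]) measurable
  finally show ?thesis by simp
qed

section \<open>Exponential integrability\<close>

lemma exp_times_le:
  assumes "K \<le> ennreal r" "p \<ge> 0" "r \<ge> 0"
  shows "exp_times p K \<le> ennreal (exp (p * r))"
proof -
  have "K \<noteq> \<infinity>" using assms(1) by (auto simp: top_unique)
  moreover have "enn2real K \<le> r" using enn2real_mono[OF assms(1)] assms(3) by simp
  ultimately show ?thesis
    using assms(2) by (simp add: exp_times_def mult_left_mono)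
qed

lemma finite_distortion_with_beurling_ahlfors:
  assumes h: "increasing_homeomorphism h"
  shows "finite_distortion_with upper_half_plane upper_half_plane
    (beurling_ahlfors h) (beurling_ahlfors_deriv h)"
proof -
  let ?U = upper_half_plane and ?L = "beurling_ahlfors_deriv h"
  note h' = increasing_homeomorphismD[OF h]
  have U: "?U \<subseteq> {z. Im z \<noteq> 0}" by (auto simp: upper_half_plane_def)
  have cont: "continuous_on ?U (\<lambda>z. ?L z v)" for v
    by (rule continuous_on_subset[OF continuous_on_beurling_ahlfors_deriv[OF h'(2)] U])
  have "W11_loc_with ?U (beurling_ahlfors h) ?L"
    by (intro W11_loc_with_of_C1 open_upper_half_plane cont linear_beurling_ahlfors_deriv
        has_derivative_beurling_ahlfors h') (use U in auto)
  moreover have "orientation_preserving_on ?U (beurling_ahlfors h)"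
    by (intro orientation_preserving_symmetrize separately_increasing_forward_mean
        continuous_on_forward_mean h h')
  moreover have "(\<lambda>z. jacobian (?L z)) locally_integrable_on ?U"
    unfolding jacobian_eq by (intro locally_integrable_on_of_continuous continuous_intros cont)
  moreover have "dilatation (?L z) < \<infinity>" if "z \<in> ?U" for z
    using dilatation_beurling_ahlfors_le(1)[OF h, of "Im z" "Re z"] that
    by (auto simp: upper_half_plane_def top.not_eq_extremum intro: le_less_trans)
  ultimately show ?thesis
    unfolding finite_distortion_with_def
    using open_upper_half_plane homeomorphic_extension_beurling_ahlfors(2)[OF h] by blast
qed

text \<open>
  The exponential of a maximum of three distortions is at most the sum of their exponentials, and the
  two shifted terms are shears of the first.  The exponent $q/64$ compensates the constant in the
  dilatation bound.
\<close>

lemma exponentially_integrable_distortion_beurling_ahlfors: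
  assumes h: "increasing_homeomorphism h" and q: "q > 0"
    and int: "(\<integral>\<^sup>+z\<in>upper_half_plane.
           ennreal (exp (q * symmetric_distortion h (Re z) (Im z))) \<partial>spherical_measure) < \<infinity>"
  shows "exponentially_integrable_distortion upper_half_plane upper_half_plane (beurling_ahlfors h)"
proof -
  let ?U = upper_half_plane and ?L = "beurling_ahlfors_deriv h"
  note h' = increasing_homeomorphismD[OF h]
  define f where "f z = ennreal (exp (q * symmetric_distortion h (Re z) (Im z)))" for z
  define S where "S c z = Complex (Re z + c * Im z) (Im z / 2)" for c z
  have [measurable]: "h \<in> borel_measurable borel"
    by (rule borel_measurable_continuous_onI[OF h'(2)])
  have f[measurable]: "f \<in> borel_measurable borel"
    unfolding f_def[abs_def] symmetric_distortion_def by measurable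
  have [measurable]: "S c \<in> borel_measurable borel" for c
    unfolding S_def[abs_def] Complex_eq by measurable
  have sets: "sets spherical_measure = sets lebesgue" by (simp add: spherical_measure_def)
  have to_spherical: "g \<in> borel_measurable spherical_measure"
    if "g \<in> borel_measurable borel" for g :: "complex \<Rightarrow> ennreal"
  proof -
    have "g \<in> borel_measurable lebesgue" using that by (intro measurable_completion) simp
    thus ?thesis by (simp add: measurable_cong_sets[OF sets refl])
  qed
  have [measurable]: "?U \<in> sets borel" using open_upper_half_plane by simp
  have pointwise: "exp_times (q / 64) (dilatation (?L z)) \<le> f z + f (S (1/4) z) + f (S (-1/4) z)"
    if z: "z \<in> ?U" for z
  proof -
    define \<rho> where "\<rho> w = symmetric_distortion h (Re w) (Im w)" for w
    define R where "R = max (\<rho> z) (max (\<rho> (S (1/4) z)) (\<rho> (S (-1/4) z)))"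
    have y: "Im z > 0" using z by (simp add: upper_half_plane_def)
    have "R \<ge> 1"
      using symmetric_distortion_ge(3)[OF h'(1) y, of "Re z"] by (simp add: R_def \<rho>_def le_max_iff_disj)
    moreover have "dilatation (?L z) \<le> ennreal (64 * R)"
      using dilatation_beurling_ahlfors_le(1)[OF h y, of "Re z"] by (simp add: R_def \<rho>_def S_def)
    ultimately have "exp_times (q / 64) (dilatation (?L z)) \<le> ennreal (exp (q / 64 * (64 * R)))"
      using q by (intro exp_times_le) auto
    also have "\<dots> = ennreal (exp (q * R))" by simp
    also have "\<dots> \<le> f z + f (S (1/4) z) + f (S (-1/4) z)"
    proof -
      have "R = \<rho> z \<or> R = \<rho> (S (1/4) z) \<or> R = \<rho> (S (-1/4) z)" by (auto simp: R_def max_def)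
      hence "ennreal (exp (q * R)) \<in> {f z, f (S (1/4) z), f (S (-1/4) z)}"
        by (auto simp: f_def \<rho>_def)
      thus ?thesis by (auto simp: add_increasing add_increasing2)
    qed
    finally show ?thesis .
  qed
  have "(\<integral>\<^sup>+z\<in>?U. exp_times (q / 64) (dilatation (?L z)) \<partial>spherical_measure)
      \<le> (\<integral>\<^sup>+z. f z * indicator ?U z + f (S (1/4) z) * indicator ?U z
           + f (S (-1/4) z) * indicator ?U z \<partial>spherical_measure)"
    using pointwise by (intro nn_integral_mono) (auto simp: indicator_def)
  also have "\<dots> = (\<integral>\<^sup>+z\<in>?U. f z \<partial>spherical_measure)
      + (\<integral>\<^sup>+z\<in>?U. f (S (1/4) z) \<partial>spherical_measure)
      + (\<integral>\<^sup>+z\<in>?U. f (S (-1/4) z) \<partial>spherical_measure)"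
  proof -
    have "(\<lambda>z. f z * indicator ?U z) \<in> borel_measurable spherical_measure"
      "(\<lambda>z. f (S c z) * indicator ?U z) \<in> borel_measurable spherical_measure" for c
      by (rule to_spherical; measurable)+
    thus ?thesis by (subst nn_integral_add; simp)+
  qed
  also have "\<dots> \<le> (\<integral>\<^sup>+z\<in>?U. f z \<partial>spherical_measure)
      + 8 * (\<integral>\<^sup>+z\<in>?U. f z \<partial>spherical_measure) + 8 * (\<integral>\<^sup>+z\<in>?U. f z \<partial>spherical_measure)"
    unfolding S_def by (intro add_mono order_refl nn_integral_spherical_shear_le f) auto
  also have "\<dots> < \<infinity>"
    using int unfolding f_def by (simp add: ennreal_mult_less_top)
  finally have "\<exists>p>0. (\<integral>\<^sup>+z\<in>?U. exp_times p (dilatation (?L z)) \<partial>spherical_measure) < \<infinity>"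
    using q by (intro exI[of _ "q / 64"]) auto
  thus ?thesis
    unfolding exponentially_integrable_distortion_def
    using finite_distortion_with_beurling_ahlfors[OF h] by blast
qed

theorem theorem1p1:
  fixes h :: "real \<Rightarrow> real"
  assumes "increasing_homeomorphism h"
    and "\<exists>q>0. (\<integral>\<^sup>+z\<in>upper_half_plane.
           ennreal (exp (q * symmetric_distortion h (Re z) (Im z))) \<partial>spherical_measure) < \<infinity>"
  shows "\<exists>H. homeomorphic_extension h H \<and>
             exponentially_integrable_distortion upper_half_plane upper_half_plane H"
  using assms homeomorphic_extension_beurling_ahlfors(1)
    exponentially_integrable_distortion_beurling_ahlfors by blast

end
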